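(* Let $Y$ be an invariant set and let $X$ be a finitely supported subset of $Y$ such that $X$ is not FSM uniformly infinite. Then the set $\wp_{fin}(X)$ of finite subsets of $X$ (regarded as a finitely supported subset of the invariant set $\wp_{fs}(Y)$) is not FSM uniformly infinite.
   Context: Fix an infinite set $A$ whose elements are called atoms. $S_A$ is the group of all bijections of $A$ that are compositions of finitely many transpositions $(a\,b)$. An $S_A$-set is a set with a group action $\cdot$ of $S_A$. For $S\subseteq A$, $Fix(S)=\{\pi\in S_A:\pi(a)=a\ \forall a\in S\}$; $S$ supports $x$ if $\pi\cdot x=x$ for all $\pi\in Fix(S)$; if $x$ has a finite supporting set, the least finite supporting set is denoted $supp(x)$. An invariant set is an $S_A$-set in which every element has a finite supporting set. For an $S_A$-set $Y$, the powerset carries the action $\pi\star Z=\{\pi\cdot z: z\in Z\}$, and $\wp_{fs}(Y)$ is the set of subsets of $Y$ finitely supported with respect to $\star$ (an invariant set when $Y$ is). A finitely supported subset of $Y$ is an element of $\wp_{fs}(Y)$. A set $Z$ is uniformly supported if some finite $S\subseteq A$ supports every element of $Z$. For $X\in\wp_{fs}(Y)$, $\wp_{fin}(X)$ is the set of finite subsets of $X$; it is a subset of $\wp_{fs}(Y)$ supported by $supp(X)$. A finitely supported subset $X$ of an invariant set is FSM uniformly infinite if it contains an infinite uniformly supported subset, and FSM non-uniformly infinite otherwise. *)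

theory Defs
  imports "HOL-Combinatorics.Permutations" "HOL-Algebra.Group_Action"
begin

section \<open>Finitely supported sets\<close>

text \<open>
  The atoms are the elements of a set \<open>A\<close>. An element of \<open>S\<^sub>A\<close> is represented by its extension to the
  whole type that is the identity outside \<open>A\<close>.
\<close>

definition fin_sym_group :: "'a set \<Rightarrow> ('a \<Rightarrow> 'a) monoid" where
  "fin_sym_group A =
    \<lparr>carrier = {apply_transps ts | ts. set ts \<subseteq> A \<times> A}, mult = (\<circ>), one = id\<rparr>"

definition Fix :: "'a set \<Rightarrow> 'a set \<Rightarrow> ('a \<Rightarrow> 'a) set" where
  "Fix A S = {\<pi> \<in> carrier (fin_sym_group A). \<forall>a\<in>S. \<pi> a = a}"

definition supports ::
    "'a set \<Rightarrow> (('a \<Rightarrow> 'a) \<Rightarrow> 'b \<Rightarrow> 'b) \<Rightarrow> 'a set \<Rightarrow> 'b \<Rightarrow> bool" where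
  "supports A \<phi> S x \<longleftrightarrow> S \<subseteq> A \<and> (\<forall>\<pi>\<in>Fix A S. \<phi> \<pi> x = x)"

definition finitely_supported ::
    "'a set \<Rightarrow> (('a \<Rightarrow> 'a) \<Rightarrow> 'b \<Rightarrow> 'b) \<Rightarrow> 'b \<Rightarrow> bool" where
  "finitely_supported A \<phi> x \<longleftrightarrow> (\<exists>S. finite S \<and> supports A \<phi> S x)"

definition invariant_set ::
    "'a set \<Rightarrow> 'b set \<Rightarrow> (('a \<Rightarrow> 'a) \<Rightarrow> 'b \<Rightarrow> 'b) \<Rightarrow> bool" where
  "invariant_set A Y \<phi> \<longleftrightarrow>
    group_action (fin_sym_group A) Y \<phi> \<and> (\<forall>y\<in>Y. finitely_supported A \<phi> y)"

text \<open>
  The library's \<open>group_action\<close> requires the maps \<open>\<phi> \<pi>\<close> to be extensional on the set acted upon, hence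
  the restrictions in the next two actions.
\<close>

definition Pow_action ::
    "'b set \<Rightarrow> (('a \<Rightarrow> 'a) \<Rightarrow> 'b \<Rightarrow> 'b) \<Rightarrow> ('a \<Rightarrow> 'a) \<Rightarrow> 'b set \<Rightarrow> 'b set" where
  "Pow_action Y \<phi> \<pi> = (\<lambda>Z\<in>Pow Y. \<phi> \<pi> ` Z)"

definition fs_Pow ::
    "'a set \<Rightarrow> 'b set \<Rightarrow> (('a \<Rightarrow> 'a) \<Rightarrow> 'b \<Rightarrow> 'b) \<Rightarrow> 'b set set" where
  "fs_Pow A Y \<phi> = {Z \<in> Pow Y. finitely_supported A (Pow_action Y \<phi>) Z}"

definition fs_Pow_action ::
    "'a set \<Rightarrow> 'b set \<Rightarrow> (('a \<Rightarrow> 'a) \<Rightarrow> 'b \<Rightarrow> 'b) \<Rightarrow> ('a \<Rightarrow> 'a) \<Rightarrow> 'b set \<Rightarrow> 'b set" where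
  "fs_Pow_action A Y \<phi> \<pi> = restrict (Pow_action Y \<phi> \<pi>) (fs_Pow A Y \<phi>)"

definition uniformly_supported ::
    "'a set \<Rightarrow> (('a \<Rightarrow> 'a) \<Rightarrow> 'b \<Rightarrow> 'b) \<Rightarrow> 'b set \<Rightarrow> bool" where
  "uniformly_supported A \<phi> Z \<longleftrightarrow> (\<exists>S\<subseteq>A. finite S \<and> (\<forall>z\<in>Z. supports A \<phi> S z))"

text \<open>
  Meant for \<open>X \<in> fs_Pow A Y \<phi>\<close> with \<open>invariant_set A Y \<phi>\<close>.
\<close>

definition FSM_uniformly_infinite ::
    "'a set \<Rightarrow> (('a \<Rightarrow> 'a) \<Rightarrow> 'b \<Rightarrow> 'b) \<Rightarrow> 'b set \<Rightarrow> bool" where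
  "FSM_uniformly_infinite A \<phi> X \<longleftrightarrow>
    (\<exists>Z\<subseteq>X. infinite Z \<and> uniformly_supported A \<phi> Z)"


section \<open>The finitely supported powerset is an invariant set\<close>

lemma apply_transps_rev:
  "apply_transps (rev ts) \<circ> apply_transps ts = id"
proof (induction ts)
  case (Cons t ts)
  have "apply_transps (rev (t # ts)) \<circ> apply_transps (t # ts) =
      apply_transps (rev ts) \<circ> (transpose (fst t) (snd t) \<circ> transpose (fst t) (snd t))
        \<circ> apply_transps ts"
    by (simp add: comp_assoc del: transpose_comp_involutory)
  then show ?case
    using Cons by simp
qed simp

lemma group_fin_sym_group: "group (fin_sym_group A)"
proof (rule groupI)
  fix p q
  assume "p \<in> carrier (fin_sym_group A)" "q \<in> carrier (fin_sym_group A)"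
  then obtain ts us where "p = apply_transps ts" "set ts \<subseteq> A \<times> A"
    and "q = apply_transps us" "set us \<subseteq> A \<times> A"
    by (auto simp: fin_sym_group_def)
  then have "p \<circ> q = apply_transps (ts @ us)" "set (ts @ us) \<subseteq> A \<times> A"
    by auto
  then show "p \<otimes>\<^bsub>fin_sym_group A\<^esub> q \<in> carrier (fin_sym_group A)"
    unfolding fin_sym_group_def by (auto simp del: apply_transps_append intro!: exI[of _ "ts @ us"])
next
  show "\<one>\<^bsub>fin_sym_group A\<^esub> \<in> carrier (fin_sym_group A)"
    unfolding fin_sym_group_def by (auto intro!: exI[of _ "[]"])
next
  fix p
  assume "p \<in> carrier (fin_sym_group A)"
  then obtain ts where ts: "p = apply_transps ts" "set ts \<subseteq> A \<times> A"
    by (auto simp: fin_sym_group_def)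
  then have "apply_transps (rev ts) \<in> carrier (fin_sym_group A)"
    unfolding fin_sym_group_def by (auto intro!: exI[of _ "rev ts"])
  then show "\<exists>q\<in>carrier (fin_sym_group A). q \<otimes>\<^bsub>fin_sym_group A\<^esub> p = \<one>\<^bsub>fin_sym_group A\<^esub>"
    using ts apply_transps_rev[of ts] by (auto simp: fin_sym_group_def)
qed (auto simp: fin_sym_group_def comp_assoc)

lemma group_actionI:
  assumes G: "group G"
    and ext: "\<And>g. g \<in> carrier G \<Longrightarrow> \<phi> g \<in> extensional E"
    and closed: "\<And>g x. g \<in> carrier G \<Longrightarrow> x \<in> E \<Longrightarrow> \<phi> g x \<in> E"
    and one: "\<And>x. x \<in> E \<Longrightarrow> \<phi> \<one>\<^bsub>G\<^esub> x = x"
    and mult: "\<And>g h x. g \<in> carrier G \<Longrightarrow> h \<in> carrier G \<Longrightarrow> x \<in> E \<Longrightarrow>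
      \<phi> (g \<otimes>\<^bsub>G\<^esub> h) x = \<phi> g (\<phi> h x)"
  shows "group_action G E \<phi>"
proof -
  interpret group G by (rule G)
  have bij: "\<phi> g \<in> Bij E" if g: "g \<in> carrier G" for g
  proof -
    have "bij_betw (\<phi> g) E E"
    proof (rule bij_betw_byWitness[where f' = "\<phi> (inv\<^bsub>G\<^esub> g)"])
      show "\<forall>x\<in>E. \<phi> (inv\<^bsub>G\<^esub> g) (\<phi> g x) = x"
        using g by (metis inv_closed l_inv mult one)
      show "\<forall>x\<in>E. \<phi> g (\<phi> (inv\<^bsub>G\<^esub> g) x) = x"
        using g by (metis inv_closed r_inv mult one)
    qed (use g closed in auto)
    then show ?thesis
      using ext[OF g] by (simp add: Bij_def)
  qed
  have hom: "\<phi> (g \<otimes>\<^bsub>G\<^esub> h) = compose E (\<phi> g) (\<phi> h)" if "g \<in> carrier G" "h \<in> carrier G" for g h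
    by (rule extensionalityI[of _ E]) (use that ext mult in \<open>auto simp: compose_def\<close>)
  have "\<phi> \<in> hom G (BijGroup E)"
    by (rule homI) (use bij hom in \<open>auto simp: BijGroup_def\<close>)
  then show ?thesis
    unfolding group_action_def group_hom_def group_hom_axioms_def
    using G group_BijGroup by blast
qed

lemma group_action_Pow:
  assumes "group_action G Y \<phi>"
  shows "group_action G (Pow Y) (Pow_action Y \<phi>)"
proof -
  interpret group_action G Y \<phi> by (rule assms)
  have G: "group G"
    using group_hom group_hom.axioms(1) by blast
  show ?thesis
  proof (rule group_actionI[OF G])
    fix g Z
    assume gZ: "g \<in> carrier G" "Z \<in> Pow Y"
    show "Pow_action Y \<phi> g Z \<in> Pow Y"
      using gZ surj_prop[of g] by (auto simp: Pow_action_def)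
  next
    fix Z
    assume "Z \<in> Pow Y"
    then show "Pow_action Y \<phi> \<one>\<^bsub>G\<^esub> Z = Z"
      by (auto simp: Pow_action_def id_eq_one[symmetric])
  next
    fix g h Z
    assume gh: "g \<in> carrier G" "h \<in> carrier G" and Z: "Z \<in> Pow Y"
    have "\<phi> h ` Z \<subseteq> Y"
      using gh Z surj_prop[of h] by auto
    moreover have "\<phi> (g \<otimes>\<^bsub>G\<^esub> h) ` Z = \<phi> g ` \<phi> h ` Z"
      unfolding image_image by (rule image_cong) (use gh Z composition_rule in auto)
    ultimately show "Pow_action Y \<phi> (g \<otimes>\<^bsub>G\<^esub> h) Z = Pow_action Y \<phi> g (Pow_action Y \<phi> h Z)"
      using Z by (simp add: Pow_action_def)
  qed (simp add: Pow_action_def)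
qed

lemma finitely_supported_action:
  assumes act: "group_action (fin_sym_group A) Y \<phi>"
    and y: "y \<in> Y" "finitely_supported A \<phi> y"
    and p: "p \<in> carrier (fin_sym_group A)"
  shows "finitely_supported A \<phi> (\<phi> p y)"
proof -
  interpret act: group_action "fin_sym_group A" Y \<phi> by (rule act)
  interpret G: group "fin_sym_group A" by (rule group_fin_sym_group)
  let ?q = "inv\<^bsub>fin_sym_group A\<^esub> p"
  have q: "?q \<in> carrier (fin_sym_group A)"
    using p by simp
  have qp: "?q (p a) = a" for a
    using G.l_inv[OF p] by (simp add: fin_sym_group_def fun_eq_iff)
  obtain S where S: "finite S" "supports A \<phi> S y"
    using y unfolding finitely_supported_def by blast
  have "p permutes A"
  proof -
    obtain ts where "p = apply_transps ts" "set ts \<subseteq> A \<times> A"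
      using p by (auto simp: fin_sym_group_def)
    then show ?thesis
      using permutes_apply_transps[of ts A] by auto
  qed
  then have pS: "p ` S \<subseteq> A"
    using S permutes_image unfolding supports_def by blast
  have "\<phi> r (\<phi> p y) = \<phi> p y" if r: "r \<in> Fix A (p ` S)" for r
  proof -
    have rc: "r \<in> carrier (fin_sym_group A)" and rS: "\<And>a. a \<in> S \<Longrightarrow> r (p a) = p a"
      using r by (auto simp: Fix_def)
    let ?c = "?q \<otimes>\<^bsub>fin_sym_group A\<^esub> (r \<otimes>\<^bsub>fin_sym_group A\<^esub> p)"
    have c: "?c \<in> carrier (fin_sym_group A)"
      using p q rc by simp
    have "?c a = ?q (r (p a))" for a
      by (simp add: fin_sym_group_def)
    then have "?c \<in> Fix A S"
      using c rS qp by (simp add: Fix_def)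
    then have "\<phi> ?c y = y"
      using S by (simp add: supports_def)
    moreover have "p \<otimes>\<^bsub>fin_sym_group A\<^esub> ?c = r \<otimes>\<^bsub>fin_sym_group A\<^esub> p"
      using p q rc by (simp add: G.m_assoc[symmetric])
    ultimately show ?thesis
      using act.composition_rule[OF y(1) p c] act.composition_rule[OF y(1) rc p] by simp
  qed
  then have "supports A \<phi> (p ` S) (\<phi> p y)"
    using pS by (simp add: supports_def)
  then show ?thesis
    using S unfolding finitely_supported_def by blast
qed

lemma supports_fs_Pow_action_iff:
  assumes "Z \<in> fs_Pow A Y \<phi>"
  shows "supports A (fs_Pow_action A Y \<phi>) S Z \<longleftrightarrow> supports A (Pow_action Y \<phi>) S Z"
  using assms by (simp add: supports_def fs_Pow_action_def)

lemma invariant_set_fs_Pow: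
  assumes "invariant_set A Y \<phi>"
  shows "invariant_set A (fs_Pow A Y \<phi>) (fs_Pow_action A Y \<phi>)"
proof -
  interpret Pow: group_action "fin_sym_group A" "Pow Y" "Pow_action Y \<phi>"
    using assms group_action_Pow unfolding invariant_set_def by blast
  have closed: "Pow_action Y \<phi> g Z \<in> fs_Pow A Y \<phi>"
    if "g \<in> carrier (fin_sym_group A)" "Z \<in> fs_Pow A Y \<phi>" for g Z
    using that Pow.element_image[of g Z] finitely_supported_action[OF Pow.group_action_axioms]
    unfolding fs_Pow_def by blast
  have "group_action (fin_sym_group A) (fs_Pow A Y \<phi>) (fs_Pow_action A Y \<phi>)"
  proof (rule group_actionI[OF group_fin_sym_group])
    fix Z
    assume "Z \<in> fs_Pow A Y \<phi>"
    then show "fs_Pow_action A Y \<phi> \<one>\<^bsub>fin_sym_group A\<^esub> Z = Z"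
      by (simp add: fs_Pow_action_def Pow.id_eq_one[symmetric] fs_Pow_def)
  next
    fix g h Z
    assume gh: "g \<in> carrier (fin_sym_group A)" "h \<in> carrier (fin_sym_group A)"
      and Z: "Z \<in> fs_Pow A Y \<phi>"
    then show "fs_Pow_action A Y \<phi> (g \<otimes>\<^bsub>fin_sym_group A\<^esub> h) Z =
        fs_Pow_action A Y \<phi> g (fs_Pow_action A Y \<phi> h Z)"
      using closed[OF gh(2) Z] Pow.composition_rule[of Z g h]
      by (simp add: fs_Pow_action_def fs_Pow_def)
  qed (use closed in \<open>auto simp: fs_Pow_action_def\<close>)
  moreover have "finitely_supported A (fs_Pow_action A Y \<phi>) Z" if "Z \<in> fs_Pow A Y \<phi>" for Z
    using that supports_fs_Pow_action_iff[OF that]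
    unfolding finitely_supported_def fs_Pow_def by blast
  ultimately show ?thesis
    unfolding invariant_set_def by blast
qed

lemma finite_in_fs_Pow:
  assumes inv: "invariant_set A Y \<phi>" and Z: "finite Z" "Z \<subseteq> Y"
  shows "Z \<in> fs_Pow A Y \<phi>"
proof -
  have "\<forall>z\<in>Z. \<exists>S. finite S \<and> supports A \<phi> S z"
    using inv Z unfolding invariant_set_def finitely_supported_def by blast
  then obtain S where S: "\<forall>z\<in>Z. finite (S z) \<and> supports A \<phi> (S z) z"
    by metis
  have "\<phi> p z = z" if "p \<in> Fix A (\<Union>z\<in>Z. S z)" "z \<in> Z" for p z
  proof -
    have "p \<in> Fix A (S z)"
      using that by (auto simp: Fix_def)
    then show ?thesis
      using S that by (simp add: supports_def)
  qed
  then have "supports A (Pow_action Y \<phi>) (\<Union>z\<in>Z. S z) Z"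
    using S Z by (auto simp: supports_def Pow_action_def)
  moreover have "finite (\<Union>z\<in>Z. S z)"
    using S Z by simp
  ultimately show ?thesis
    using Z unfolding fs_Pow_def finitely_supported_def by blast
qed

lemma Fpow_in_fs_Pow:
  assumes inv: "invariant_set A Y \<phi>" and X: "X \<in> fs_Pow A Y \<phi>"
  shows "Fpow X \<in> fs_Pow A (fs_Pow A Y \<phi>) (fs_Pow_action A Y \<phi>)"
proof -
  have XY: "X \<subseteq> Y"
    using X by (simp add: fs_Pow_def)
  have sub: "Fpow X \<subseteq> fs_Pow A Y \<phi>"
    using finite_in_fs_Pow[OF inv] XY by (auto simp: Fpow_def)
  obtain S where S: "finite S" "supports A (Pow_action Y \<phi>) S X"
    using X unfolding fs_Pow_def finitely_supported_def by blast
  have "fs_Pow_action A Y \<phi> p ` Fpow X = Fpow X" if p: "p \<in> Fix A S" for p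
  proof -
    have pX: "\<phi> p ` X = X"
      using p S XY by (simp add: supports_def Pow_action_def)
    have "fs_Pow_action A Y \<phi> p ` Fpow X = (\<lambda>Z. \<phi> p ` Z) ` Fpow X"
    proof (rule image_cong[OF refl])
      fix Z
      assume "Z \<in> Fpow X"
      then have "Z \<in> fs_Pow A Y \<phi>" "Z \<subseteq> Y"
        using sub XY by (auto simp: Fpow_def)
      then show "fs_Pow_action A Y \<phi> p Z = \<phi> p ` Z"
        by (simp add: fs_Pow_action_def Pow_action_def)
    qed
    also have "\<dots> = Fpow (\<phi> p ` X)"
      by (auto simp: Fpow_def dest: finite_subset_image)
    finally show ?thesis
      using pX by simp
  qed
  then have "supports A (Pow_action (fs_Pow A Y \<phi>) (fs_Pow_action A Y \<phi>)) S (Fpow X)"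
    using S sub by (simp add: supports_def Pow_action_def)
  then show ?thesis
    using S sub unfolding fs_Pow_def[of A "fs_Pow A Y \<phi>"] finitely_supported_def by blast
qed

end

theory Submission
  imports Defs
begin

text \<open>
  If a finite set \<open>Z\<close> is supported by a finite set \<open>S\<close>, then \<open>S\<close> supports every \<open>z \<in> Z\<close>. Indeed, let a
  finite \<open>T \<supseteq> S\<close> support \<open>z\<close> and let \<open>a \<in> T - S\<close>. The elements \<open>(a c) \<cdot> z\<close> with \<open>c\<close> outside \<open>S\<close> lie in
  the finite set \<open>Z\<close>, so \<open>(a c) \<cdot> z = (a d) \<cdot> z\<close> for distinct fresh \<open>c\<close>, \<open>d\<close>; since \<open>(c d) \<cdot> z = z\<close>, this
  forces \<open>(a c) \<cdot> z = z\<close>. Hence \<open>a\<close> is exchangeable with a fresh atom and can be removed from \<open>T\<close>.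
  Consequently the union of a family of finite subsets of \<open>X\<close> uniformly supported by \<open>S\<close> is itself
  uniformly supported by \<open>S\<close>, so it is finite, and the family consists of subsets of it.
\<close>

lemma transpose_in_fin_sym_group:
  assumes "a \<in> A" "b \<in> A"
  shows "transpose a b \<in> carrier (fin_sym_group A)"
  unfolding fin_sym_group_def using assms by (auto intro!: exI[of _ "[(a, b)]"])

lemma transpose_in_Fix:
  assumes "a \<in> A - S" "b \<in> A - S"
  shows "transpose a b \<in> Fix A S"
  using assms by (auto simp: Fix_def transpose_in_fin_sym_group intro!: transpose_apply_other)

lemma finite_moved_apply_transps: "finite {x. apply_transps ts x \<noteq> x}"
proof (rule finite_subset)
  let ?B = "fst ` set ts \<union> snd ` set ts"
  show "{x. apply_transps ts x \<noteq> x} \<subseteq> ?B"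
  proof
    fix x
    assume x: "x \<in> {x. apply_transps ts x \<noteq> x}"
    have "apply_transps ts permutes ?B"
      by (rule permutes_apply_transps) force
    then show "x \<in> ?B"
      using x by (auto simp: permutes_def)
  qed
qed simp

text \<open>Used to choose a fresh atom that also avoids every point moved by a given
  permutation.\<close>

lemma finite_moved_fin_sym_group:
  assumes "p \<in> carrier (fin_sym_group A)"
  shows "finite {x. p x \<noteq> x}"
  using assms finite_moved_apply_transps by (auto simp: fin_sym_group_def)

lemma comp_in_fin_sym_group:
  assumes "p \<in> carrier (fin_sym_group A)" "q \<in> carrier (fin_sym_group A)"
  shows "p \<circ> q \<in> carrier (fin_sym_group A)"
proof -
  interpret group "fin_sym_group A" by (rule group_fin_sym_group)
  show ?thesis
    using m_closed[OF assms] by (simp add: fin_sym_group_def)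
qed

lemma fin_sym_group_action_comp:
  assumes "group_action (fin_sym_group A) Y \<phi>" "y \<in> Y"
    and "p \<in> carrier (fin_sym_group A)" "q \<in> carrier (fin_sym_group A)"
  shows "\<phi> (p \<circ> q) y = \<phi> p (\<phi> q y)"
  using group_action.composition_rule[OF assms] by (simp add: fin_sym_group_def)

lemma transpose_action_involutory:
  assumes "group_action (fin_sym_group A) Y \<phi>" "y \<in> Y" "a \<in> A" "b \<in> A"
  shows "\<phi> (transpose a b) (\<phi> (transpose a b) y) = y"
proof -
  have "\<phi> (transpose a b) (\<phi> (transpose a b) y) = \<phi> id y"
    using fin_sym_group_action_comp[OF assms(1,2), of "transpose a b" "transpose a b"] assms
    by (simp add: transpose_in_fin_sym_group)
  also have "\<dots> = y"
    using fun_cong[OF group_action.id_eq_one[OF assms(1)], of y] assms(2)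
    by (simp add: fin_sym_group_def)
  finally show ?thesis .
qed

lemma supports_mono:
  assumes "supports A \<phi> S x" "S \<subseteq> T" "T \<subseteq> A"
  shows "supports A \<phi> T x"
proof -
  have "Fix A T \<subseteq> Fix A S"
    using assms(2) by (auto simp: Fix_def)
  then show ?thesis
    using assms by (auto simp: supports_def)
qed

text \<open>A permutation \<open>p\<close> fixing \<open>T - {a}\<close> may move \<open>a\<close>,
  but its conjugate by a suitable \<open>transpose a c\<close> fixes all of \<open>T\<close> and
  hence \<open>z\<close>. As the transposition fixes \<open>z\<close> too, so does \<open>p\<close>.
  The atom \<open>c\<close> depends on \<open>p\<close>, hence the quantification over
  \<open>F\<close> in \<open>swap\<close>.\<close>

lemma supports_remove:
  assumes act: "group_action (fin_sym_group A) Y \<phi>" and z: "z \<in> Y"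
    and T: "supports A \<phi> T z" "finite T" and a: "a \<in> A"
    and swap: "\<And>F. finite F \<Longrightarrow> \<exists>c\<in>A - F. \<phi> (transpose a c) z = z"
  shows "supports A \<phi> (T - {a}) z"
  unfolding supports_def
proof (intro conjI ballI)
  show "T - {a} \<subseteq> A"
    using T by (auto simp: supports_def)
next
  fix p
  assume p: "p \<in> Fix A (T - {a})"
  then have pc: "p \<in> carrier (fin_sym_group A)" and pT: "\<And>x. x \<in> T \<Longrightarrow> x \<noteq> a \<Longrightarrow> p x = x"
    by (auto simp: Fix_def)
  \<comment> \<open>Avoiding the moved points gives \<open>p c = c\<close>, so the conjugate fixes
    \<open>a\<close>; avoiding \<open>T\<close> makes it fix the remaining atoms of
    \<open>T\<close>.\<close>
  obtain c where c: "c \<in> A - (T \<union> {a} \<union> {x. p x \<noteq> x})" and cz: "\<phi> (transpose a c) z = z"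
    using swap[of "T \<union> {a} \<union> {x. p x \<noteq> x}"] T(2) finite_moved_fin_sym_group[OF pc] by auto
  let ?t = "transpose a c"
  have t: "?t \<in> carrier (fin_sym_group A)"
    using a c by (simp add: transpose_in_fin_sym_group)
  have pt: "p \<circ> ?t \<in> carrier (fin_sym_group A)"
    using pc t by (rule comp_in_fin_sym_group)
  have "(?t \<circ> (p \<circ> ?t)) x = x" if "x \<in> T" for x
  proof (cases "x = a")
    case False
    moreover have "x \<noteq> c"
      using that c by auto
    ultimately show ?thesis
      using that pT by simp
  qed (use c in simp)
  then have "?t \<circ> (p \<circ> ?t) \<in> Fix A T"
    using comp_in_fin_sym_group[OF t pt] by (simp add: Fix_def)
  then have "\<phi> (?t \<circ> (p \<circ> ?t)) z = z"
    using T by (simp add: supports_def)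
  moreover have "\<phi> (?t \<circ> (p \<circ> ?t)) z = \<phi> ?t (\<phi> p z)"
    using fin_sym_group_action_comp[OF act z t pt] fin_sym_group_action_comp[OF act z pc t] cz
    by simp
  ultimately have "\<phi> ?t (\<phi> ?t (\<phi> p z)) = z"
    using cz by simp
  moreover have "\<phi> p z \<in> Y"
    using group_action.element_image[OF act pc z] by simp
  ultimately show "\<phi> p z = z"
    using transpose_action_involutory[OF act] a c by simp
qed

text \<open>Finiteness of \<open>Z\<close> is essential: the set of all atoms is supported by the
  empty set, but no single atom is.\<close>

lemma supports_member_of_finite:
  assumes A: "infinite A" and inv: "invariant_set A Y \<phi>"
    and Z: "finite Z" "Z \<subseteq> Y" and S: "finite S" "supports A (Pow_action Y \<phi>) S Z"
    and z: "z \<in> Z"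
  shows "supports A \<phi> S z"
proof -
  have act: "group_action (fin_sym_group A) Y \<phi>"
    using inv by (simp add: invariant_set_def)
  have zY: "z \<in> Y"
    using Z z by blast
  have SA: "S \<subseteq> A"
    using S by (simp add: supports_def)
  obtain T\<^sub>0 where T\<^sub>0: "finite T\<^sub>0" "supports A \<phi> T\<^sub>0 z"
    using inv zY unfolding invariant_set_def finitely_supported_def by blast
  have T\<^sub>0A: "T\<^sub>0 \<subseteq> A"
    using T\<^sub>0 by (simp add: supports_def)
  have in_Z: "\<phi> p z \<in> Z" if "p \<in> Fix A S" for p
  proof -
    have "\<phi> p ` Z = Z"
      using that S(2) Z(2) by (simp add: supports_def Pow_action_def)
    then show ?thesis
      using z by blast
  qed
  have swap: "\<exists>c\<in>A - F. \<phi> (transpose a c) z = z" if a: "a \<in> A - S" and F: "finite F" for a F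
  proof -
    \<comment> \<open>Avoiding \<open>S\<close> keeps the images of \<open>z\<close> inside
      \<open>Z\<close>; avoiding \<open>T\<^sub>0\<close> makes \<open>transpose c d\<close> fix
      \<open>z\<close>.\<close>
    let ?C = "A - (F \<union> S \<union> T\<^sub>0 \<union> {a})"
    have "infinite ?C"
      using A F S(1) T\<^sub>0(1) by simp
    moreover have "(\<lambda>c. \<phi> (transpose a c) z) ` ?C \<subseteq> Z"
      using a by (auto intro!: in_Z transpose_in_Fix)
    ultimately have "\<not> inj_on (\<lambda>c. \<phi> (transpose a c) z) ?C"
      using Z(1) finite_subset inj_on_finite by blast
    then obtain c d where c: "c \<in> ?C" and d: "d \<in> ?C" and cd: "c \<noteq> d"
      and eq: "\<phi> (transpose a c) z = \<phi> (transpose a d) z"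
      unfolding inj_on_def by blast
    have ac: "transpose a c \<in> carrier (fin_sym_group A)"
      and ad: "transpose a d \<in> carrier (fin_sym_group A)"
      and cd': "transpose c d \<in> carrier (fin_sym_group A)"
      using a c d by (auto intro: transpose_in_fin_sym_group)
    have "\<phi> (transpose c d) z = z"
      using T\<^sub>0(2) transpose_in_Fix[of c A T\<^sub>0 d] c d by (auto simp: supports_def)
    \<comment> \<open>Applied to \<open>z\<close>, this identity shows that
      \<open>transpose a d\<close> fixes the common image
      \<open>\<phi> (transpose a c) z = \<phi> (transpose a d) z\<close>; being an involution, it
      also sends that image back to \<open>z\<close>.\<close>
    moreover have "transpose a d \<circ> (transpose a c \<circ> transpose c d) = transpose a c"
      using c d cd by (auto simp: fun_eq_iff transpose_def)
    ultimately have "\<phi> (transpose a c) z = \<phi> (transpose a d) (\<phi> (transpose a c) z)"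
      using fin_sym_group_action_comp[OF act zY ad comp_in_fin_sym_group[OF ac cd']]
        fin_sym_group_action_comp[OF act zY ac cd'] by simp
    also have "\<dots> = z"
      unfolding eq using transpose_action_involutory[OF act zY] a d by simp
    finally show ?thesis
      using c by blast
  qed
  \<comment> \<open>Enlarging \<open>T\<^sub>0\<close> by \<open>S\<close> ensures that exactly
    \<open>S\<close> remains once the atoms of \<open>T\<^sub>0 - S\<close> are removed one by
    one.\<close>
  have "supports A \<phi> (S \<union> T\<^sub>0 - D) z" if "finite D" "D \<subseteq> A - S" for D
    using that
  proof (induction D)
    case empty
    show ?case
      using supports_mono[OF T\<^sub>0(2)] SA T\<^sub>0A by simp
  next
    case (insert a D)
    have "supports A \<phi> (S \<union> T\<^sub>0 - D - {a}) z"
      by (rule supports_remove[OF act zY]) (use insert S(1) T\<^sub>0(1) swap in auto)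
    moreover have "S \<union> T\<^sub>0 - insert a D = S \<union> T\<^sub>0 - D - {a}"
      by blast
    ultimately show ?case
      by simp
  qed
  from this[of "T\<^sub>0 - S"] have "supports A \<phi> (S \<union> T\<^sub>0 - (T\<^sub>0 - S)) z"
    using T\<^sub>0(1) T\<^sub>0A by blast
  moreover have "S \<union> T\<^sub>0 - (T\<^sub>0 - S) = S"
    by blast
  ultimately show ?thesis
    by simp
qed

theorem theorem3p3:
  fixes A :: "'a set" and Y X :: "'b set"
    and \<phi> :: "('a \<Rightarrow> 'a) \<Rightarrow> 'b \<Rightarrow> 'b"
  assumes "infinite A"
    and "invariant_set A Y \<phi>"
    and "X \<in> fs_Pow A Y \<phi>"
    and "\<not> FSM_uniformly_infinite A \<phi> X"
  shows "\<not> FSM_uniformly_infinite A (fs_Pow_action A Y \<phi>) (Fpow X)"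
proof
  assume "FSM_uniformly_infinite A (fs_Pow_action A Y \<phi>) (Fpow X)"
  then obtain F S where F: "F \<subseteq> Fpow X" "infinite F"
    and S: "S \<subseteq> A" "finite S" "\<forall>Z\<in>F. supports A (fs_Pow_action A Y \<phi>) S Z"
    unfolding FSM_uniformly_infinite_def uniformly_supported_def by blast
  have "X \<subseteq> Y"
    using assms(3) by (simp add: fs_Pow_def)
  have "supports A \<phi> S z" if "Z \<in> F" "z \<in> Z" for Z z
  proof -
    have Z: "finite Z" "Z \<subseteq> Y"
      using F(1) that(1) \<open>X \<subseteq> Y\<close> by (auto simp: Fpow_def)
    have "supports A (Pow_action Y \<phi>) S Z"
      using S(3) that(1) supports_fs_Pow_action_iff[OF finite_in_fs_Pow[OF assms(2) Z]] by blast
    then show ?thesis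
      using supports_member_of_finite[OF assms(1,2) Z S(2)] that(2) by blast
  qed
  then have "uniformly_supported A \<phi> (\<Union>F)"
    using S(1,2) unfolding uniformly_supported_def by blast
  moreover have "\<Union>F \<subseteq> X"
    using F(1) by (auto simp: Fpow_def)
  ultimately have "finite (\<Union>F)"
    using assms(4) unfolding FSM_uniformly_infinite_def by blast
  \<comment> \<open>The infinite family \<open>F\<close> would lie in the powerset of the finite set
    \<open>\<Union>F\<close>.\<close>
  then show False
    using F(2) finite_UnionD by blast
qed

end
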